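(* Let $X,Y,Z,W$ be real topological linear spaces, let $Y_+\subseteq Y$, $Z_+\subseteq Z$, $W_+\subseteq W$ be pointed closed convex cones with nonempty interiors, and let $f:X\to 2^Y$, $g:X\to 2^Z$, $h:X\to 2^W$ be set-valued functions. Consider the vector optimization problem (VP) of minimizing $f$ with respect to $Y_+$ over the feasible set $D=\{x\in X: g(x)\cap(-Z_+)\neq\emptyset,\ O\in h(x)\}$. Let $\bar x\in D$. If there exists $(\bar\xi,\bar\eta,\bar\varsigma)\in(Y_+^*\setminus\{O\})\times Z_+^*\times W^*$ for which $(\bar x,\bar\eta,\bar\varsigma)$ is a scalar saddle-point of the Lagrangian function $l_{\bar\xi}$, then $\bar x$ is a weakly efficient solution of (VP), and $\bar\eta(g(\bar x))=\{0\}$, $\bar\varsigma(h(\bar x))=\{0\}$.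
   Context: $O$ denotes the zero element of a linear space, $2^Y$ the power set of $Y$, $Y^*$ the topological dual of $Y$, $\operatorname{int}$ the topological interior. A subset $Y_+\subseteq Y$ is a convex cone if $\alpha y^1+\beta y^2\in Y_+$ for all $y^1,y^2\in Y_+$, $\alpha,\beta\ge 0$; it is pointed if $Y_+\cap(-Y_+)=\{O\}$. The dual cone is $Y_+^*=\{\xi\in Y^*:\xi(y)\ge 0\ \forall y\in Y_+\}$; similarly for $Z_+^*$. Sums and differences of sets are Minkowski; $\xi(f(x))=\{\xi(y):y\in f(x)\}$; $f(D)=\bigcup_{x\in D}f(x)$. For sets $A,B\subseteq\mathbb R$, $A\le B$ means $a\le b$ for all $a\in A$, $b\in B$. Weakly efficient solution: $\bar x\in D$ is a weakly efficient solution of (VP) if there exists $\bar y\in f(\bar x)$ such that $(\bar y-f(D))\cap\operatorname{int}Y_+=\emptyset$. For $\bar\xi\in Y_+^*\setminus\{O\}$, the (scalar) Lagrangian function of (VP) is $l_{\bar\xi}(x,\eta,\varsigma)=\bar\xi(f(x))+\eta(g(x))+\varsigma(h(x))\subseteq\mathbb R$ for $(x,\eta,\varsigma)\in X\times Z_+^*\times W^*$. A triple $(\bar x,\bar\eta,\bar\varsigma)$ with $\bar x\in D$, $(\bar\eta,\bar\varsigma)\in Z_+^*\times W^*$ is a scalar saddle-point of $l_{\bar\xi}$ if $$l_{\bar\xi}(\bar x,\eta,\varsigma)\le l_{\bar\xi}(\bar x,\bar\eta,\bar\varsigma)\le l_{\bar\xi}(x,\bar\eta,\bar\varsigma)\qquad\forall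 x\in D,\ \forall(\eta,\varsigma)\in Z_+^*\times W^*.$$
   Formalization: The formal theorem additionally assumes that f(x̄) is nonempty; if f(x̄) is empty, the saddle-point inequalities hold vacuously while x̄ cannot be weakly efficient, so the statement would be false. *)

theory Defs
  imports "HOL-Analysis.Analysis"
begin

text \<open>Real topological linear spaces. No separation axiom is imposed.\<close>

class real_tvs = real_vector + topological_ab_group_add +
  assumes tendsto_scaleR_Pair:
    "LIM p (nhds c \<times>\<^sub>F nhds x). fst p *\<^sub>R snd p :> nhds (c *\<^sub>R x)"

instance real_normed_vector \<subseteq> real_tvs
proof
  fix c :: real and x :: 'a
  show "LIM p (nhds c \<times>\<^sub>F nhds x). fst p *\<^sub>R snd p :> nhds (c *\<^sub>R x)"
    by (intro tendsto_scaleR filterlim_fst filterlim_snd)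
qed

text \<open>
  For nonempty sets the library notion \<^const>\<open>convex_cone\<close> is closure under all
  combinations with nonnegative coefficients.
\<close>

lemma convex_cone_iff_comb:
  "convex_cone S \<longleftrightarrow>
    S \<noteq> {} \<and> (\<forall>y1\<in>S. \<forall>y2\<in>S. \<forall>\<alpha>\<ge>0. \<forall>\<beta>\<ge>0. \<alpha> *\<^sub>R y1 + \<beta> *\<^sub>R y2 \<in> S)"
  (is "_ \<longleftrightarrow> _ \<and> ?comb")
proof
  assume "convex_cone S"
  then show "S \<noteq> {} \<and> ?comb"
    by (auto simp: convex_cone_iff)
next
  assume R: "S \<noteq> {} \<and> ?comb"
  then have comb: "\<alpha> *\<^sub>R y1 + \<beta> *\<^sub>R y2 \<in> S"
    if "y1 \<in> S" "y2 \<in> S" "0 \<le> \<alpha>" "0 \<le> \<beta>" for y1 y2 \<alpha> \<beta>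
    using that by blast
  obtain s where "s \<in> S" using R by blast
  have "0 \<in> S" using comb[OF \<open>s \<in> S\<close> \<open>s \<in> S\<close>, of 0 0] by simp
  moreover have "x + y \<in> S" if "x \<in> S" "y \<in> S" for x y
    using comb[OF that, of 1 1] by simp
  moreover have "c *\<^sub>R x \<in> S" if "x \<in> S" "0 \<le> c" for x c
    using comb[OF that(1) that(1) that(2), of 0] by simp
  ultimately show "convex_cone S" by (simp add: convex_cone_iff)
qed

text \<open>Beware that \<open>- C\<close> denotes the complement of a set; negation is \<open>uminus ` C\<close>.\<close>

definition pointed :: "'a::real_vector set \<Rightarrow> bool" where
  "pointed C \<longleftrightarrow> C \<inter> uminus ` C = {0}"

definition top_dual :: "('a::real_tvs \<Rightarrow> real) set" where
  "top_dual = {\<xi>. linear \<xi> \<and> continuous_on UNIV \<xi>}"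

definition dual_cone :: "'a::real_tvs set \<Rightarrow> ('a \<Rightarrow> real) set" where
  "dual_cone C = {\<xi> \<in> top_dual. \<forall>y\<in>C. 0 \<le> \<xi> y}"

text \<open>The elementwise order on sets of reals; \<open>\<le>\<close> on sets is inclusion.\<close>

definition set_le :: "real set \<Rightarrow> real set \<Rightarrow> bool" where
  "set_le A B \<longleftrightarrow> (\<forall>a\<in>A. \<forall>b\<in>B. a \<le> b)"

definition feasible ::
  "('x \<Rightarrow> 'z::real_tvs set) \<Rightarrow> ('x \<Rightarrow> 'w::real_tvs set) \<Rightarrow> 'z set \<Rightarrow> 'x set" where
  "feasible g h Zp = {x. g x \<inter> uminus ` Zp \<noteq> {} \<and> 0 \<in> h x}"

definition weakly_efficient ::
  "('x \<Rightarrow> 'y::real_tvs set) \<Rightarrow> 'y set \<Rightarrow> 'x set \<Rightarrow> 'x \<Rightarrow> bool" where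
  "weakly_efficient f Yp D xbar \<longleftrightarrow>
     xbar \<in> D \<and>
     (\<exists>ybar\<in>f xbar. (\<lambda>y. ybar - y) ` (\<Union>x\<in>D. f x) \<inter> interior Yp = {})"

text \<open>The sums below are Minkowski sums of sets of reals.\<close>

definition lagrangian ::
  "('x \<Rightarrow> 'y set) \<Rightarrow> ('x \<Rightarrow> 'z set) \<Rightarrow> ('x \<Rightarrow> 'w set) \<Rightarrow> ('y \<Rightarrow> real) \<Rightarrow>
   'x \<Rightarrow> ('z \<Rightarrow> real) \<Rightarrow> ('w \<Rightarrow> real) \<Rightarrow> real set" where
  "lagrangian f g h \<xi> x \<eta> \<zeta> = \<xi> ` f x + \<eta> ` g x + \<zeta> ` h x"

definition scalar_saddle_point ::
  "('x \<Rightarrow> 'y::real_tvs set) \<Rightarrow> ('x \<Rightarrow> 'z::real_tvs set) \<Rightarrow> ('x \<Rightarrow> 'w::real_tvs set) \<Rightarrow>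
   'z set \<Rightarrow> ('y \<Rightarrow> real) \<Rightarrow> 'x \<Rightarrow> ('z \<Rightarrow> real) \<Rightarrow> ('w \<Rightarrow> real) \<Rightarrow> bool" where
  "scalar_saddle_point f g h Zp \<xi> xbar \<eta>bar \<zeta>bar \<longleftrightarrow>
     xbar \<in> feasible g h Zp \<and> \<eta>bar \<in> dual_cone Zp \<and> \<zeta>bar \<in> top_dual \<and>
     (\<forall>x \<in> feasible g h Zp. \<forall>\<eta> \<in> dual_cone Zp. \<forall>\<zeta> \<in> top_dual.
        set_le (lagrangian f g h \<xi> xbar \<eta> \<zeta>) (lagrangian f g h \<xi> xbar \<eta>bar \<zeta>bar) \<and>
        set_le (lagrangian f g h \<xi> xbar \<eta>bar \<zeta>bar) (lagrangian f g h \<xi> x \<eta>bar \<zeta>bar))"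

end

theory Submission
  imports Defs
begin

text \<open>
  Comparing the saddle point with the multipliers \<open>(0, 0)\<close>, \<open>(\<eta>bar, 0)\<close> and \<open>(0, \<zeta>bar)\<close> at
  a point of \<open>g xbar \<inter> - Zp\<close> and at \<open>0 \<in> h xbar\<close> forces complementary slackness. The right-hand
  saddle inequality then says that \<open>\<xi>bar\<close> is minimal on \<open>f xbar\<close> over the feasible set, while a
  nonzero element of the dual cone is strictly positive on the interior of the cone.
\<close>

lemma real_tvs_tendsto_scaleR:
  fixes a :: "'b \<Rightarrow> 'a::real_tvs"
  assumes "(r \<longlongrightarrow> c) F" "(a \<longlongrightarrow> x) F"
  shows "((\<lambda>t. r t *\<^sub>R a t) \<longlongrightarrow> c *\<^sub>R x) F"
  using filterlim_compose[OF tendsto_scaleR_Pair filterlim_Pair[OF assms]] by simp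

text \<open>A direction \<open>v\<close> with \<open>\<xi> v > 0\<close> exists up to sign. From an
  interior point there is room to move a short way against \<open>v\<close> inside \<open>C\<close>,
  so nonnegativity of \<open>\<xi>\<close> there leaves the margin \<open>t * \<xi> v\<close> at
  \<open>p\<close>.\<close>

lemma dual_cone_pos_interior:
  assumes \<xi>: "\<xi> \<in> dual_cone C" "\<xi> \<noteq> (\<lambda>_. 0)" and p: "p \<in> interior C"
  shows "0 < \<xi> p"
proof -
  have lin: "linear \<xi>" and nonneg: "\<And>y. y \<in> C \<Longrightarrow> 0 \<le> \<xi> y"
    using \<xi>(1) by (auto simp: dual_cone_def top_dual_def)
  interpret linear \<xi> by (rule lin)
  obtain u where "\<xi> u \<noteq> 0" using \<xi>(2) by auto
  then obtain v where v: "0 < \<xi> v"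
    by (metis neg neg_0_less_iff_less linorder_neqE_linordered_idom)
  \<comment> \<open>Without a norm, the step length comes from continuity of scalar multiplication:
    the path tends to \<open>p\<close> and eventually enters its open neighbourhood
    \<open>interior C\<close>.\<close>
  have "((\<lambda>t. p - t *\<^sub>R v) \<longlongrightarrow> p - 0 *\<^sub>R v) (at_right (0::real))"
    by (intro tendsto_diff tendsto_const real_tvs_tendsto_scaleR tendsto_ident_at)
  then have "\<forall>\<^sub>F t in at_right (0::real). p - t *\<^sub>R v \<in> interior C"
    using p by (auto dest: topological_tendstoD[OF _ open_interior])
  then have "\<forall>\<^sub>F t in at_right (0::real). 0 < t \<and> p - t *\<^sub>R v \<in> C"
    using eventually_at_right_less[of "0::real"]
    by eventually_elim (use interior_subset in auto)
  then obtain t :: real where t: "0 < t" "p - t *\<^sub>R v \<in> C"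
    using eventually_happens'[OF trivial_limit_at_right_real] by blast
  then have "t * \<xi> v \<le> \<xi> p"
    using nonneg[OF t(2)] by (simp add: diff scale)
  with t(1) v show ?thesis
    by (meson mult_pos_pos order_less_le_trans)
qed

lemma zero_in_top_dual: "(\<lambda>_. 0) \<in> top_dual"
  by (simp add: top_dual_def linear_zero)

lemma zero_in_dual_cone: "(\<lambda>_. 0) \<in> dual_cone C"
  by (simp add: dual_cone_def zero_in_top_dual)

lemma dual_cone_nonpos:
  assumes "\<eta> \<in> dual_cone C" "z \<in> uminus ` C"
  shows "\<eta> z \<le> 0"
  using assms by (auto simp: dual_cone_def top_dual_def linear_neg)

lemma top_dual_zero: "\<zeta> \<in> top_dual \<Longrightarrow> \<zeta> 0 = 0"
  by (simp add: top_dual_def linear_0)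

lemma lagrangianI:
  "y \<in> f x \<Longrightarrow> z \<in> g x \<Longrightarrow> w \<in> h x \<Longrightarrow> \<xi> y + \<eta> z + \<zeta> w \<in> lagrangian f g h \<xi> x \<eta> \<zeta>"
  unfolding lagrangian_def by (intro set_plus_intro imageI)

text \<open>The order on sets is elementwise, so the points on the two sides may be chosen
  independently; equal \<open>y\<close> and \<open>y'\<close> then cancel the objective.\<close>

lemma saddle_point_left:
  assumes "scalar_saddle_point f g h C \<xi> x \<eta>' \<zeta>'"
    and "\<eta> \<in> dual_cone C" "\<zeta> \<in> top_dual"
    and "y \<in> f x" "z \<in> g x" "w \<in> h x" "y' \<in> f x" "z' \<in> g x" "w' \<in> h x"
  shows "\<xi> y + \<eta> z + \<zeta> w \<le> \<xi> y' + \<eta>' z' + \<zeta>' w'"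
  using assms lagrangianI[of _ f x _ g _ h]
  unfolding scalar_saddle_point_def set_le_def by blast

lemma saddle_point_right:
  assumes "scalar_saddle_point f g h C \<xi> x \<eta>' \<zeta>'" "x' \<in> feasible g h C"
    and "y \<in> f x" "z \<in> g x" "w \<in> h x" "y' \<in> f x'" "z' \<in> g x'" "w' \<in> h x'"
  shows "\<xi> y + \<eta>' z + \<zeta>' w \<le> \<xi> y' + \<eta>' z' + \<zeta>' w'"
  using assms lagrangianI[of _ f _ _ g _ h]
  unfolding scalar_saddle_point_def set_le_def by blast

text \<open>If \<open>f x\<close> were empty, the Lagrangian at \<open>x\<close> would be empty and
  the saddle inequalities vacuous.\<close>

lemma saddle_point_complementary:
  assumes sp: "scalar_saddle_point f g h C \<xi> x \<eta> \<zeta>" and ne: "f x \<noteq> {}"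
  shows "\<eta> ` g x = {0}" "\<zeta> ` h x = {0}"
proof -
  have \<eta>: "\<eta> \<in> dual_cone C" and \<zeta>: "\<zeta> \<in> top_dual" and "x \<in> feasible g h C"
    using sp by (auto simp: scalar_saddle_point_def)
  then obtain z0 where z0: "z0 \<in> g x" "z0 \<in> uminus ` C" and w0: "0 \<in> h x"
    by (auto simp: feasible_def)
  obtain y where y: "y \<in> f x" using ne by blast
  note left = saddle_point_left[OF sp]
  have nonneg: "0 \<le> \<eta> z + \<zeta> w" if "z \<in> g x" "w \<in> h x" for z w
    using left[OF zero_in_dual_cone zero_in_top_dual y that y that] by simp
  have \<zeta>0: "\<zeta> 0 = 0" by (rule top_dual_zero[OF \<zeta>])
  \<comment> \<open>The zero multipliers bound \<open>\<eta> z0\<close> from below, the membership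
    of \<open>z0\<close> in the negative cone from above.\<close>
  have \<eta>0: "\<eta> z0 = 0"
    using nonneg[OF z0(1) w0] dual_cone_nonpos[OF \<eta> z0(2)] \<zeta>0 by simp
  \<comment> \<open>Keeping \<open>\<eta>\<close> but placing \<open>z\<close> on the left and
    \<open>z0\<close> on the right gives \<open>\<eta> z \<le> \<eta> z0 = 0\<close>.\<close>
  have "\<eta> z = 0" if "z \<in> g x" for z
    using nonneg[OF that w0] left[OF \<eta> zero_in_top_dual y that w0 y z0(1) w0] \<zeta>0 \<eta>0 by simp
  then show "\<eta> ` g x = {0}" using z0(1) by force
  \<comment> \<open>Likewise, keeping \<open>\<zeta>\<close> and comparing \<open>w\<close> with
    \<open>0\<close> gives \<open>\<zeta> w \<le> 0\<close>.\<close>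
  have "\<zeta> w = 0" if "w \<in> h x" for w
    using nonneg[OF z0(1) that] left[OF zero_in_dual_cone \<zeta> y z0(1) that y z0(1) w0] \<zeta>0 \<eta>0
    by simp
  then show "\<zeta> ` h x = {0}" using w0 by force
qed

text \<open>Any point of \<open>f x\<close> serves as the witness, because the saddle inequalities
  hold for all its elements.\<close>

lemma saddle_point_weakly_efficient:
  assumes sp: "scalar_saddle_point f g h C \<xi> x \<eta> \<zeta>" and ne: "f x \<noteq> {}"
    and \<xi>: "\<xi> \<in> dual_cone K" "\<xi> \<noteq> (\<lambda>_. 0)"
  shows "weakly_efficient f K (feasible g h C) x"
proof -
  have \<eta>: "\<eta> \<in> dual_cone C" and \<zeta>: "\<zeta> \<in> top_dual" and x: "x \<in> feasible g h C"
    using sp by (auto simp: scalar_saddle_point_def)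
  obtain z where z: "z \<in> g x" and w: "0 \<in> h x"
    using x by (auto simp: feasible_def)
  have \<eta>z: "\<eta> z = 0" using saddle_point_complementary(1)[OF sp ne] z by blast
  have \<zeta>0: "\<zeta> 0 = 0" by (rule top_dual_zero[OF \<zeta>])
  obtain y where y: "y \<in> f x" using ne by blast
  have "y - y' \<notin> interior K" if x': "x' \<in> feasible g h C" and y': "y' \<in> f x'" for x' y'
  proof
    assume "y - y' \<in> interior K"
    then have "0 < \<xi> (y - y')" by (rule dual_cone_pos_interior[OF \<xi>])
    then have "\<xi> y' < \<xi> y"
      using \<xi>(1) by (auto simp: dual_cone_def top_dual_def linear_diff)
    moreover obtain z' where z': "z' \<in> g x'" "z' \<in> uminus ` C" and w': "0 \<in> h x'"
      using x' by (auto simp: feasible_def)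
    \<comment> \<open>With the constraint terms zero at \<open>x\<close> and nonpositive at
      \<open>z'\<close> and \<open>0\<close>, the right-hand inequality yields
      \<open>\<xi> y \<le> \<xi> y'\<close>.\<close>
    ultimately show False
      using saddle_point_right[OF sp x' y z w y' z'(1) w'] dual_cone_nonpos[OF \<eta> z'(2)] \<eta>z \<zeta>0
      by simp
  qed
  then show ?thesis
    using x y by (auto simp: weakly_efficient_def)
qed

theorem theorem4p2:
  fixes f :: "'x::real_tvs \<Rightarrow> 'y::real_tvs set"
    and g :: "'x \<Rightarrow> 'z::real_tvs set"
    and h :: "'x \<Rightarrow> 'w::real_tvs set"
    and Yp :: "'y set" and Zp :: "'z set" and Wp :: "'w set"
    and xbar :: 'x
    and \<xi>bar :: "'y \<Rightarrow> real" and \<eta>bar :: "'z \<Rightarrow> real" and \<zeta>bar :: "'w \<Rightarrow> real"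
  assumes "convex_cone Yp" and "pointed Yp" and "closed Yp" and "interior Yp \<noteq> {}"
    and "convex_cone Zp" and "pointed Zp" and "closed Zp" and "interior Zp \<noteq> {}"
    and "convex_cone Wp" and "pointed Wp" and "closed Wp" and "interior Wp \<noteq> {}"
    and "xbar \<in> feasible g h Zp"
    and "f xbar \<noteq> {}"
    and "\<xi>bar \<in> dual_cone Yp - {\<lambda>_. 0}"
    and "\<eta>bar \<in> dual_cone Zp"
    and "\<zeta>bar \<in> top_dual"
    and "scalar_saddle_point f g h Zp \<xi>bar xbar \<eta>bar \<zeta>bar"
  shows "weakly_efficient f Yp (feasible g h Zp) xbar
    \<and> \<eta>bar ` g xbar = {0}
    \<and> \<zeta>bar ` h xbar = {0}"
proof (intro conjI)
  note sp = \<open>scalar_saddle_point f g h Zp \<xi>bar xbar \<eta>bar \<zeta>bar\<close> and ne = \<open>f xbar \<noteq> {}\<close>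
  show "weakly_efficient f Yp (feasible g h Zp) xbar"
    using saddle_point_weakly_efficient[OF sp ne] \<open>\<xi>bar \<in> dual_cone Yp - {\<lambda>_. 0}\<close> by simp
  show "\<eta>bar ` g xbar = {0}" "\<zeta>bar ` h xbar = {0}"
    by (rule saddle_point_complementary[OF sp ne])+
qed

end
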